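(* Let $J\in\mathbb{N}$ and let $f:\mathbb{R}\to\mathbb{R}$ be a differentiable function with bounded derivative. Let $\boldsymbol{c}^{(J)}$ be the real-valued sequence sampled from $f$ over the grid $2^{-J}\mathbb{Z}$, i.e. $c^{(J)}_j=f(2^{-J}j)$, $j\in\mathbb{Z}$. Let $\mathcal{S}_{\boldsymbol{\alpha}}$ be a refinement operator with mask $\boldsymbol{\alpha}$, and let $\mathcal{D}_{\boldsymbol{\gamma}}$ be its pseudo-reverse for some $\xi>0$. Let $\{\boldsymbol{c}^{(0)};\boldsymbol{d}^{(1)},\dots,\boldsymbol{d}^{(J)}\}$ be the multiscale representation of $\boldsymbol{c}^{(J)}$ using $\mathcal{S}_{\boldsymbol{\alpha}}$ and $\mathcal{D}_{\boldsymbol{\gamma}}$. Then for every $\ell=1,\dots,J$, $$\|\boldsymbol{d}^{(\ell)}\downarrow 2\|_\infty\le P(\xi)\,(2\|\boldsymbol{\gamma}\|_1)^{-\ell},\qquad P(\xi)=L(\xi)\,\|\boldsymbol{\gamma}\|_1^J\,\|f'\|_\infty,$$ where $$L(\xi)=\|\boldsymbol{\alpha}-\widetilde{\boldsymbol{\alpha}}\|_1K_{\boldsymbol{\gamma}}+\|\boldsymbol{\gamma}\|_1K_{\boldsymbol{\alpha}-\widetilde{\boldsymbol{\alpha}}},\qquad K_{\boldsymbol{b}}:=2\sum_{j\in\mathbb{Z}}|b_j|\,|j|.$$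
   Context: Sequences are indexed by $\mathbb{Z}$; at scale $\ell$ the index $j$ corresponds to the grid point $2^{-\ell}j$. For a sequence $\boldsymbol{b}$, $(\boldsymbol{b}\downarrow 2)_j=b_{2j}$, and its symbol is $\boldsymbol{b}(z)=\sum_{k\in\mathbb{Z}}b_kz^k$. $\|\cdot\|_1$ and $\|\cdot\|_\infty$ are the $\ell_1(\mathbb{Z})$ and $\ell_\infty(\mathbb{Z})$ norms; $\|f'\|_\infty=\sup_{x\in\mathbb{R}}|f'(x)|$; $\mathbb{T}=\{z\in\mathbb{C}:|z|=1\}$. Refinement operator: for a finitely supported real mask $\boldsymbol{\alpha}$ with $\sum_k\alpha_{2k}=\sum_k\alpha_{2k+1}=1$, $\mathcal{S}_{\boldsymbol{\alpha}}(\boldsymbol{c})_j=\sum_{k\in\mathbb{Z}}\alpha_{j-2k}c_k$. Standing assumption: the subdivision scheme $\mathcal{S}_{\boldsymbol{\alpha}}$ is convergent, i.e. for every bounded $\boldsymbol{c}$ there is a continuous $F:\mathbb{R}\to\mathbb{R}$ with $\lim_{k\to\infty}\sup_j|(\mathcal{S}_{\boldsymbol{\alpha}}^k\boldsymbol{c})_j-F(2^{-k}j)|=0$, with $F\not\equiv0$ for some $\boldsymbol{c}$. Decimation operator: for $\boldsymbol{\gamma}\in\ell_1(\mathbb{Z})$, $\mathcal{D}_{\boldsymbol{\gamma}}(\boldsymbol{c})_j=\sum_{k\in\mathbb{Z}}\gamma_{j-k}c_{2k}$. Pseudo-reversing: let $p$ be a polynomial with $p(1)=1$ and let $\Lambda$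 be the multiset of its zeros (with multiplicity). For $\xi>0$ put $$p_\xi^{-\dagger}(z)=C\prod_{r\in\Lambda\setminus\mathbb{T}}(z-r)\prod_{r\in\Lambda\cap\mathbb{T}}(z-(1+\xi)r),$$ with the constant $C$ determined by $p_\xi^{-\dagger}(1)=1$, and $p_\xi^\dagger=1/p_\xi^{-\dagger}$. For the Laurent polynomial $(\boldsymbol{\alpha}\downarrow2)(z)=z^{-m}q(z)$, with $q$ a polynomial, $q(0)\ne0$, put $(\boldsymbol{\alpha}\downarrow2)_\xi^{-\dagger}(z)=z^{-m}q_\xi^{-\dagger}(z)$ and $(\boldsymbol{\alpha}\downarrow2)_\xi^{\dagger}=1/(\boldsymbol{\alpha}\downarrow2)_\xi^{-\dagger}$. $\mathcal{D}_{\boldsymbol{\gamma}}$ is the pseudo-reverse of $\mathcal{S}_{\boldsymbol{\alpha}}$ for the parameter $\xi$ if $\boldsymbol{\gamma}(z)=(\boldsymbol{\alpha}\downarrow2)_\xi^\dagger(z)$ on $\mathbb{T}$, i.e. $\boldsymbol{\gamma}\in\ell_1(\mathbb{Z})$ is the sequence of Fourier coefficients of this function (which does not vanish and has no poles on $\mathbb{T}$). The approximating mask $\widetilde{\boldsymbol{\alpha}}$ is defined by: $\widetilde{\boldsymbol{\alpha}}\downarrow2$ has symbol $(\boldsymbol{\alpha}\downarrow2)_\xi^{-\dagger}(z)$, and $\widetilde\alpha_{2k+1}=\alpha_{2k+1}$ for all $k$. Multiscale representation of $\boldsymbol{c}^{(J)}$ using $\mathcal{S}_{\boldsymbol{\alpha}},\mathcal{D}_{\boldsymbol{\gamma}}$: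 recursively for $\ell=J,J-1,\dots,1$, $\boldsymbol{c}^{(\ell-1)}=\mathcal{D}_{\boldsymbol{\gamma}}\boldsymbol{c}^{(\ell)}$ and $\boldsymbol{d}^{(\ell)}=\boldsymbol{c}^{(\ell)}-\mathcal{S}_{\boldsymbol{\alpha}}\boldsymbol{c}^{(\ell-1)}$. *)

theory Defs
  imports "HOL-Analysis.Analysis" "HOL-Computational_Algebra.Computational_Algebra"
begin

definition down2 :: "(int \<Rightarrow> 'a) \<Rightarrow> int \<Rightarrow> 'a" where
  "down2 b j = b (2 * j)"

(* Used only where the series converges absolutely: finitely supported b and z \<noteq> 0,
   or b in l_1 and z on the unit circle. *)
definition symbol :: "(int \<Rightarrow> real) \<Rightarrow> complex \<Rightarrow> complex" where
  "symbol b z = (\<Sum>\<^sub>\<infinity>k. of_real (b k) * z powi k)"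

definition l1_norm :: "(int \<Rightarrow> real) \<Rightarrow> real" where
  "l1_norm b = (\<Sum>\<^sub>\<infinity>k. \<bar>b k\<bar>)"

(* Extended-valued: linf_norm b is \<infinity> for unbounded b, so a finite upper bound
   includes boundedness. *)
definition linf_norm :: "(int \<Rightarrow> real) \<Rightarrow> ereal" where
  "linf_norm b = (SUP j. ereal \<bar>b j\<bar>)"

(* The constant K_b. The series converges for finitely supported b, and for the masks of
   pseudo-reverses, which decay exponentially (Laurent coefficients of a rational function
   without poles on the unit circle). *)
definition K_const :: "(int \<Rightarrow> real) \<Rightarrow> real" where
  "K_const b = 2 * (\<Sum>\<^sub>\<infinity>j. \<bar>b j\<bar> * \<bar>real_of_int j\<bar>)"

definition refine :: "(int \<Rightarrow> real) \<Rightarrow> (int \<Rightarrow> real) \<Rightarrow> int \<Rightarrow> real" where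
  "refine \<alpha> c j = (\<Sum>\<^sub>\<infinity>k. \<alpha> (j - 2 * k) * c k)"

definition decimate :: "(int \<Rightarrow> real) \<Rightarrow> (int \<Rightarrow> real) \<Rightarrow> int \<Rightarrow> real" where
  "decimate \<gamma> c j = (\<Sum>\<^sub>\<infinity>k. \<gamma> (j - k) * c (2 * k))"

definition refinement_mask :: "(int \<Rightarrow> real) \<Rightarrow> bool" where
  "refinement_mask \<alpha> \<longleftrightarrow>
     finite {k. \<alpha> k \<noteq> 0} \<and> (\<Sum>\<^sub>\<infinity>k. \<alpha> (2 * k)) = 1 \<and> (\<Sum>\<^sub>\<infinity>k. \<alpha> (2 * k + 1)) = 1"

definition subdivision_limit :: "(int \<Rightarrow> real) \<Rightarrow> (int \<Rightarrow> real) \<Rightarrow> (real \<Rightarrow> real) \<Rightarrow> bool" where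
  "subdivision_limit \<alpha> c F \<longleftrightarrow> continuous_on UNIV F \<and>
     (\<lambda>k. linf_norm (\<lambda>j. (refine \<alpha> ^^ k) c j - F (real_of_int j / 2 ^ k))) \<longlonglongrightarrow> 0"

definition convergent_scheme :: "(int \<Rightarrow> real) \<Rightarrow> bool" where
  "convergent_scheme \<alpha> \<longleftrightarrow>
     (\<forall>c. bounded (range c) \<longrightarrow> (\<exists>F. subdivision_limit \<alpha> c F)) \<and>
     (\<exists>c F. bounded (range c) \<and> subdivision_limit \<alpha> c F \<and> (\<exists>x. F x \<noteq> 0))"

definition pseudo_zero_prod :: "real \<Rightarrow> complex poly \<Rightarrow> complex \<Rightarrow> complex" where
  "pseudo_zero_prod \<xi> p z =
     (\<Prod>r\<in>#filter_mset (\<lambda>r. norm r \<noteq> 1) (proots p). z - r) *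
     (\<Prod>r\<in>#filter_mset (\<lambda>r. norm r = 1) (proots p). z - of_real (1 + \<xi>) * r)"

(* p_xi^{-dagger}; the leading factor is the constant C normalising the value at 1. For
   p(1) = 1 and xi > 0 no factor vanishes at 1. *)
definition pseudo_inv :: "real \<Rightarrow> complex poly \<Rightarrow> complex \<Rightarrow> complex" where
  "pseudo_inv \<xi> p z = inverse (pseudo_zero_prod \<xi> p 1) * pseudo_zero_prod \<xi> p z"

(* For finitely supported b \<noteq> 0, the unique factorisation b(z) = z^{-m} q(z) with q a
   polynomial, q(0) \<noteq> 0, has m = - laurent_ord b and q = laurent_poly b;
   see symbol_eq_laurent below. *)
definition laurent_ord :: "(int \<Rightarrow> real) \<Rightarrow> int" where
  "laurent_ord b = Min {k. b k \<noteq> 0}"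

definition laurent_poly :: "(int \<Rightarrow> real) \<Rightarrow> complex poly" where
  "laurent_poly b = (\<Sum>k | b k \<noteq> 0. monom (of_real (b k)) (nat (k - laurent_ord b)))"

lemma symbol_eq_laurent:
  assumes fin: "finite {k. b k \<noteq> 0}" and "z \<noteq> 0"
  shows "symbol b z = z powi laurent_ord b * poly (laurent_poly b) z"
proof -
  have le: "laurent_ord b \<le> k" if "b k \<noteq> 0" for k
    unfolding laurent_ord_def using fin that by auto
  have "symbol b z = (\<Sum>\<^sub>\<infinity>k\<in>{k. b k \<noteq> 0}. of_real (b k) * z powi k)"
    unfolding symbol_def by (rule infsum_cong_neutral) auto
  also have "\<dots> = (\<Sum>k | b k \<noteq> 0. of_real (b k) * z powi k)"
    using fin by simp
  also have "\<dots> = (\<Sum>k | b k \<noteq> 0. z powi laurent_ord b *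
      (of_real (b k) * z ^ nat (k - laurent_ord b)))"
  proof (rule sum.cong)
    fix k assume "k \<in> {k. b k \<noteq> 0}"
    then have "z ^ nat (k - laurent_ord b) = z powi (k - laurent_ord b)"
      using le[of k] by (simp add: power_int_def)
    moreover have "z powi k = z powi laurent_ord b * z powi (k - laurent_ord b)"
      using \<open>z \<noteq> 0\<close> by (simp flip: power_int_add)
    ultimately show "of_real (b k) * z powi k = z powi laurent_ord b *
      (of_real (b k) * z ^ nat (k - laurent_ord b))" by simp
  qed simp
  also have "\<dots> = z powi laurent_ord b * poly (laurent_poly b) z"
    unfolding laurent_poly_def by (simp add: poly_sum poly_monom sum_distrib_left)
  finally show ?thesis .
qed

lemma poly_laurent_poly_0:
  assumes fin: "finite {k. b k \<noteq> 0}" and ne: "{k. b k \<noteq> 0} \<noteq> {}"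
  shows "poly (laurent_poly b) 0 \<noteq> 0"
proof -
  have mem: "b (laurent_ord b) \<noteq> 0"
    using Min_in[OF fin ne] unfolding laurent_ord_def by simp
  have le: "laurent_ord b \<le> k" if "b k \<noteq> 0" for k
    unfolding laurent_ord_def using fin that by auto
  have "poly (laurent_poly b) 0 =
      (\<Sum>k | b k \<noteq> 0. if k = laurent_ord b then of_real (b k) else 0)"
    unfolding laurent_poly_def poly_sum poly_monom
    by (rule sum.cong) (use le in \<open>fastforce simp: power_0_left\<close>)+
  also have "\<dots> = of_real (b (laurent_ord b))"
    using fin mem by simp
  finally show ?thesis using mem by simp
qed

(* (b)_xi^{-dagger} for a Laurent polynomial b(z) = z^{-m} q(z). *)
definition laurent_pseudo_inv :: "real \<Rightarrow> (int \<Rightarrow> real) \<Rightarrow> complex \<Rightarrow> complex" where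
  "laurent_pseudo_inv \<xi> b z = z powi laurent_ord b * pseudo_inv \<xi> (laurent_poly b) z"

(* The zeros of the real polynomial q are closed under conjugation, hence so are the shifted
   ones; the Fourier coefficients below, and those of the approximating mask, are therefore
   real and both masks can be typed as real sequences. *)
definition pseudo_reverse :: "real \<Rightarrow> (int \<Rightarrow> real) \<Rightarrow> (int \<Rightarrow> real) \<Rightarrow> bool" where
  "pseudo_reverse \<xi> \<alpha> \<gamma> \<longleftrightarrow> (\<lambda>k. \<bar>\<gamma> k\<bar>) summable_on UNIV \<and>
     (\<forall>z. norm z = 1 \<longrightarrow> symbol \<gamma> z = 1 / laurent_pseudo_inv \<xi> (down2 \<alpha>) z)"

definition approximating_mask :: "real \<Rightarrow> (int \<Rightarrow> real) \<Rightarrow> (int \<Rightarrow> real) \<Rightarrow> bool" where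
  "approximating_mask \<xi> \<alpha> \<alpha>' \<longleftrightarrow> finite {k. \<alpha>' k \<noteq> 0} \<and>
     (\<forall>z. z \<noteq> 0 \<longrightarrow> symbol (down2 \<alpha>') z = laurent_pseudo_inv \<xi> (down2 \<alpha>) z) \<and>
     (\<forall>k. \<alpha>' (2 * k + 1) = \<alpha> (2 * k + 1))"

definition multiscale_rep :: "(int \<Rightarrow> real) \<Rightarrow> (int \<Rightarrow> real) \<Rightarrow> nat \<Rightarrow>
    (nat \<Rightarrow> int \<Rightarrow> real) \<Rightarrow> (nat \<Rightarrow> int \<Rightarrow> real) \<Rightarrow> bool" where
  "multiscale_rep \<alpha> \<gamma> J c d \<longleftrightarrow>
     (\<forall>l\<in>{1..J}. c (l - 1) = decimate \<gamma> (c l) \<and>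
        d l = (\<lambda>j. c l j - refine \<alpha> (c (l - 1)) j))"

end

theory Submission
  imports Defs
begin

text \<open>
  Each coarsening step multiplies the Lipschitz constant of the data by at most
  \<open>2 * l1_norm \<gamma>\<close>: downsampling doubles it, and convolution with \<open>\<gamma>\<close> costs
  the factor \<open>l1_norm \<gamma>\<close>. The even details at a level are the downsampled data convolved with
  \<open>\<gamma>\<close> and with the even part of \<open>\<alpha>' - \<alpha>\<close>, a kernel of sum zero with finite first
  moment; hence they are bounded by a multiple of the Lipschitz constant of that level. The first
  moment of \<open>\<gamma>\<close> is finite because its symbol is, up to a monomial, the reciprocal of a
  polynomial without zeros on the unit circle, and dividing by one linear factor at a time keeps the
  first moment finite.
\<close>

section \<open>Absolutely convergent Fourier series and uniqueness of their coefficients\<close>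

text \<open>A complex counterpart of \<open>symbol\<close>: multiplication by a single factor
  \<open>z - r\<close> with non-real \<open>r\<close> leaves the real sequences.\<close>

definition fourier_sum :: "(int \<Rightarrow> complex) \<Rightarrow> complex \<Rightarrow> complex" where
  "fourier_sum b z = (\<Sum>\<^sub>\<infinity>k. b k * z powi k)"

lemma infsum_sum_swap:
  fixes f :: "'i \<Rightarrow> 'a \<Rightarrow> 'b :: {topological_comm_monoid_add, t2_space}"
  assumes "finite I" and "\<And>i. i \<in> I \<Longrightarrow> f i summable_on A"
  shows "(\<lambda>x. \<Sum>i\<in>I. f i x) summable_on A"
    and "(\<Sum>\<^sub>\<infinity>x\<in>A. \<Sum>i\<in>I. f i x) = (\<Sum>i\<in>I. infsum (f i) A)"
proof -
  have "((\<lambda>x. \<Sum>i\<in>I. f i x) has_sum (\<Sum>i\<in>I. infsum (f i) A)) A"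
    using assms
    by (induction I rule: finite_induct) (auto intro!: has_sum_add has_sum_infsum has_sum_0)
  then show "(\<lambda>x. \<Sum>i\<in>I. f i x) summable_on A"
    and "(\<Sum>\<^sub>\<infinity>x\<in>A. \<Sum>i\<in>I. f i x) = (\<Sum>i\<in>I. infsum (f i) A)"
    by (auto simp: summable_on_def infsumI)
qed

lemma abs_summable_fourier:
  fixes b :: "int \<Rightarrow> complex"
  assumes "(\<lambda>k. norm (b k)) summable_on UNIV" and "norm z = 1"
  shows "(\<lambda>k. norm (b k * z powi k)) summable_on UNIV"
  using assms by (simp add: norm_mult norm_power_int)

lemma summable_fourier:
  fixes b :: "int \<Rightarrow> complex"
  assumes "(\<lambda>k. norm (b k)) summable_on UNIV" and "norm z = 1"
  shows "(\<lambda>k. b k * z powi k) summable_on UNIV"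
  using Infinite_Sum.abs_summable_summable[OF abs_summable_fourier[OF assms]] .

text \<open>Orthogonality of the characters of a cyclic group: the summands are the powers of the
  \<open>N\<close>-th root of unity \<open>x\<close>, so their geometric sum is zero unless
  \<open>x = 1\<close>.\<close>

lemma sum_powi_roots_of_unity:
  assumes "N > 0"
  shows "(\<Sum>t<N. cis (2 * pi * real t / real N) powi n) = (if int N dvd n then of_nat N else 0)"
proof -
  define x where "x = cis (2 * pi * real_of_int n / real N)"
  have pow: "cis (2 * pi * real t / real N) powi n = x ^ t" for t
    by (simp add: x_def cis_power_int Complex.DeMoivre field_simps)
  have xN: "x ^ N = 1"
    using assms by (simp add: x_def Complex.DeMoivre)
  show ?thesis
  proof (cases "int N dvd n")
    case True
    then obtain k where "n = int N * k" by (auto simp: dvd_def)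
    then have "x = 1"
      using assms cis_multiple_2pi[of "real_of_int k"]
      by (simp add: x_def mult.assoc del: cis_multiple_2pi)
    then show ?thesis using True by (simp add: pow)
  next
    case False
    have "x \<noteq> 1"
    proof
      assume "x = 1"
      then have "cos (2 * pi * real_of_int n / real N) = 1"
        by (simp add: x_def complex_eq_iff)
      then obtain k :: int where "2 * pi * real_of_int n / real N = real_of_int k * 2 * pi"
        by (auto simp: cos_one_2pi_int)
      then have "real_of_int n = real_of_int (k * int N)"
        using assms by (simp add: field_simps)
      then have "n = k * int N" by (simp only: of_int_eq_iff)
      then show False using False by simp
    qed
    then show ?thesis
      using False xN by (simp add: pow geometric_sum)
  qed
qed

text \<open>Averaging \<open>z powi (- k) * fourier_sum b z\<close> over the \<open>N\<close>-th roots of unity leaves the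
  coefficients with index congruent to \<open>k\<close> modulo \<open>N\<close>; for large \<open>N\<close> all of them but \<open>b k\<close> lie
  in the tail of the series.\<close>
lemma fourier_sum_unique_zero:
  assumes b: "(\<lambda>k. norm (b k)) summable_on UNIV" and zero: "\<And>z. norm z = 1 \<Longrightarrow> fourier_sum b z = 0"
  shows "b k = 0"
proof -
  have "norm (b k) \<le> \<epsilon>" if "\<epsilon> > 0" for \<epsilon>
  proof -
    from infsum_finite_approximation[OF b that] obtain F where F: "finite F"
      and Fd: "dist (\<Sum>k\<in>F. norm (b k)) (\<Sum>\<^sub>\<infinity>k. norm (b k)) \<le> \<epsilon>" by blast
    \<comment> \<open>\<open>N\<close> exceeds the distance from \<open>k\<close> to every point of
      \<open>F\<close>, so no other point of \<open>F\<close> is congruent to \<open>k\<close>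
      modulo \<open>N\<close>.\<close>
    define N where "N = Suc (\<Sum>m\<in>F. nat \<bar>m - k\<bar>)"
    have N: "N > 0" by (simp add: N_def)
    have big: "\<not> int N dvd m - k" if "m \<in> F" "m \<noteq> k" for m
    proof
      assume "int N dvd m - k"
      then have "int N \<le> \<bar>m - k\<bar>" using that dvd_imp_le_int[of "m - k" "int N"] by simp
      moreover have "\<bar>m - k\<bar> \<le> (\<Sum>m\<in>F. \<bar>m - k\<bar>)"
        using F that by (intro member_le_sum) auto
      ultimately show False by (simp add: N_def)
    qed
    define w where "w t = cis (2 * pi * real t / real N)" for t
    have w: "norm (w t) = 1" "w t \<noteq> 0" for t by (auto simp: w_def)
    define h where "h m = (if int N dvd m - k then b m else 0)" for m
    have h: "(\<lambda>k. norm (h k)) summable_on UNIV"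
      by (rule Infinite_Sum.abs_summable_on_comparison_test[OF b]) (auto simp: h_def)
    have "0 = (\<Sum>t<N. w t powi (- k) * fourier_sum b (w t))"
      by (simp add: zero w)
    also have "\<dots> = (\<Sum>t<N. \<Sum>\<^sub>\<infinity>m. w t powi (- k) * (b m * w t powi m))"
      by (simp add: fourier_sum_def infsum_cmult_right')
    also have "\<dots> = (\<Sum>\<^sub>\<infinity>m. \<Sum>t<N. w t powi (- k) * (b m * w t powi m))"
      by (rule infsum_sum_swap(2)[symmetric])
         (auto intro!: summable_on_cmult_right summable_fourier b w)
    also have "\<dots> = (\<Sum>\<^sub>\<infinity>m. of_nat N * h m)"
    proof (rule infsum_cong)
      fix m
      have "(\<Sum>t<N. w t powi (- k) * (b m * w t powi m)) = b m * (\<Sum>t<N. w t powi (m - k))"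
        by (simp add: sum_distrib_left power_int_diff power_int_minus w divide_inverse mult_ac)
      also have "\<dots> = of_nat N * h m"
        using sum_powi_roots_of_unity[OF N, of "m - k"] by (simp add: w_def h_def)
      finally show "(\<Sum>t<N. w t powi (- k) * (b m * w t powi m)) = of_nat N * h m" .
    qed
    finally have "infsum h UNIV = 0"
      using N by (simp add: infsum_cmult_right')
    moreover have "infsum h UNIV = infsum h {k} + infsum h (UNIV - {k})"
      using infsum_Un_disjoint[of h "{k}" "UNIV - {k}"] summable_on_subset[OF Infinite_Sum.abs_summable_summable[OF h]]
      by simp
    ultimately have bk: "b k = - infsum h (UNIV - {k})"
      by (simp add: h_def add_eq_0_iff2)
    have sub: "(\<lambda>m. norm (b m)) summable_on A" for A
      using summable_on_subset[OF b] by blast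
    have "norm (b k) \<le> (\<Sum>\<^sub>\<infinity>m\<in>UNIV - {k}. norm (h m))"
      unfolding bk norm_minus_cancel
      by (rule norm_infsum_bound) (use summable_on_subset[OF h] in blast)
    \<comment> \<open>By \<open>big\<close>, \<open>h\<close> vanishes on \<open>F\<close> away from
      \<open>k\<close>; everywhere else it is dominated by \<open>b\<close>.\<close>
    also have "\<dots> \<le> (\<Sum>\<^sub>\<infinity>m\<in>UNIV - F. norm (b m))"
      by (rule infsum_mono_neutral)
         (use summable_on_subset[OF h] sub big in \<open>auto simp: h_def\<close>)
    also have "\<dots> = (\<Sum>\<^sub>\<infinity>m. norm (b m)) - (\<Sum>m\<in>F. norm (b m))"
      using infsum_Un_disjoint[of "\<lambda>m. norm (b m)" F "UNIV - F"] sub F by simp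
    also have "\<dots> \<le> \<epsilon>" using Fd by (simp add: dist_real_def)
    finally show ?thesis .
  qed
  then show ?thesis
    by (metis field_le_epsilon add_0 norm_le_zero_iff)
qed

lemma bij_shift_int: "bij_betw (\<lambda>k::int. k - i) UNIV UNIV"
  by (rule bij_betwI[where g = "\<lambda>k. k + i"]) auto

lemma fourier_sum_shift:
  assumes "norm z = 1"
  shows "fourier_sum (\<lambda>k. b (k - i)) z = z powi i * fourier_sum b z"
proof -
  have z: "z \<noteq> 0" using assms by auto
  have "fourier_sum (\<lambda>k. b (k - i)) z = (\<Sum>\<^sub>\<infinity>k. z powi i * (b (k - i) * z powi (k - i)))"
    unfolding fourier_sum_def using z
    by (intro infsum_cong) (simp add: power_int_diff)
  also have "\<dots> = z powi i * fourier_sum b z"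
    using infsum_reindex_bij_betw[OF bij_shift_int, where f = "\<lambda>k. b k * z powi k"]
    by (simp add: infsum_cmult_right' fourier_sum_def)
  finally show ?thesis .
qed

lemma fourier_sum_cmult: "fourier_sum (\<lambda>k. a * b k) z = a * fourier_sum b z"
  by (simp add: fourier_sum_def mult.assoc infsum_cmult_right')

lemma fourier_sum_diff:
  assumes "(\<lambda>k. norm (b k)) summable_on UNIV" "(\<lambda>k. norm (b' k)) summable_on UNIV" "norm z = 1"
  shows "fourier_sum (\<lambda>k. b k - b' k) z = fourier_sum b z - fourier_sum b' z"
  using infsum_add[OF summable_fourier[OF assms(1,3)]
      summable_on_uminus[THEN iffD2, OF summable_fourier[OF assms(2,3)]]]
  by (simp add: fourier_sum_def algebra_simps infsum_uminus)

lemma norm_summable_diff: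
  fixes b b' :: "'i \<Rightarrow> 'a :: real_normed_vector"
  assumes "(\<lambda>k. norm (b k)) summable_on A" "(\<lambda>k. norm (b' k)) summable_on A"
  shows "(\<lambda>k. norm (b k - b' k)) summable_on A"
  by (rule summable_on_comparison_test[OF summable_on_add[OF assms]])
     (auto intro: norm_triangle_ineq4)

lemma fourier_sum_unique:
  assumes b: "(\<lambda>k. norm (b k)) summable_on UNIV" "(\<lambda>k. norm (b' k)) summable_on UNIV"
    and eq: "\<And>z. norm z = 1 \<Longrightarrow> fourier_sum b z = fourier_sum b' z"
  shows "b = b'"
proof
  fix k
  have "b k - b' k = 0"
    by (rule fourier_sum_unique_zero[where b = "\<lambda>k. b k - b' k"])
       (auto simp: norm_summable_diff fourier_sum_diff b eq)
  then show "b k = b' k" by simp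
qed

lemma fourier_sum_single: "fourier_sum (\<lambda>k. if k = i then a else 0) z = a * z powi i"
proof -
  have "fourier_sum (\<lambda>k. if k = i then a else 0) z = (\<Sum>\<^sub>\<infinity>k\<in>{i}. a * z powi k)"
    unfolding fourier_sum_def by (rule infsum_cong_neutral) auto
  then show ?thesis by simp
qed

section \<open>First moments under division by linear factors\<close>

text \<open>On the level of symbols, \<open>g\<close> arises by division by \<open>z - r\<close>. The truncated weights
  \<open>min \<bar>k\<bar> N\<close> make all sums finite, and the resulting bound does not depend on \<open>N\<close>.\<close>
lemma first_moment_deconvolve:
  fixes g :: "int \<Rightarrow> complex" and r :: complex
  assumes r: "norm r \<noteq> 1" and g: "(\<lambda>k. norm (g k)) summable_on UNIV"
    and h: "(\<lambda>k. \<bar>real_of_int k\<bar> * norm (g (k - 1) - r * g k)) summable_on UNIV"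
  shows "(\<lambda>k. \<bar>real_of_int k\<bar> * norm (g k)) summable_on UNIV"
proof (rule nonneg_bdd_above_summable_on)
  define G where "G = (\<Sum>\<^sub>\<infinity>k. norm (g k))"
  define H where "H = (\<Sum>\<^sub>\<infinity>k. \<bar>real_of_int k\<bar> * norm (g (k - 1) - r * g k))"
  \<comment> \<open>The constant that results below from \<open>U\<close> lying within
    \<open>G\<close> of \<open>S\<close> and within \<open>H\<close> of
    \<open>norm r * S\<close>.\<close>
  define B where "B = (G + H) / \<bar>norm r - 1\<bar>"
  have r': "\<bar>norm r - 1\<bar> > 0" using r by simp
  have g1: "(\<lambda>k. norm (g (k - 1))) summable_on UNIV"
    and G1: "(\<Sum>\<^sub>\<infinity>k. norm (g (k - 1))) = G"
    using summable_on_reindex_bij_betw[OF bij_shift_int[of 1], where f = "\<lambda>k. norm (g k)"]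
      infsum_reindex_bij_betw[OF bij_shift_int[of 1], where f = "\<lambda>k. norm (g k)"] g
    by (simp_all add: G_def)
  have "sum (\<lambda>k. \<bar>real_of_int k\<bar> * norm (g k)) F \<le> B" if F: "finite F" for F :: "int set"
  proof -
    \<comment> \<open>No point of \<open>F\<close> exceeds this height in absolute value, so
      \<open>w\<close> is the full weight on \<open>F\<close>; as \<open>w\<close> is bounded, the
      series \<open>S\<close> and \<open>U\<close> converge.\<close>
    define N where "N = (\<Sum>k\<in>F. \<bar>real_of_int k\<bar>)"
    have N0: "N \<ge> 0" by (simp add: N_def sum_nonneg)
    define w where "w k = min \<bar>real_of_int k\<bar> N" for k
    have w: "0 \<le> w k" "w k \<le> N" "w k \<le> \<bar>real_of_int k\<bar>" "\<bar>w k - w (k - 1)\<bar> \<le> 1" for k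
      using N0 by (auto simp: w_def min_def abs_if)
    have wF: "w k = \<bar>real_of_int k\<bar>" if "k \<in> F" for k
      using member_le_sum[OF that, of "\<lambda>k. \<bar>real_of_int k\<bar>"] F by (simp add: w_def N_def)
    define S where "S = (\<Sum>\<^sub>\<infinity>k. w k * norm (g k))"
    define U where "U = (\<Sum>\<^sub>\<infinity>k. w k * norm (g (k - 1)))"
    have sS: "(\<lambda>k. w k * norm (g k)) summable_on UNIV"
      by (rule summable_on_comparison_test[OF summable_on_cmult_right[OF g, of N]])
         (auto intro: mult_right_mono mult_nonneg_nonneg w)
    have sU: "(\<lambda>k. w k * norm (g (k - 1))) summable_on UNIV"
      by (rule summable_on_comparison_test[OF summable_on_cmult_right[OF g1, of N]])
         (auto intro: mult_right_mono mult_nonneg_nonneg w)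
    have sS1: "(\<lambda>k. w (k - 1) * norm (g (k - 1))) summable_on UNIV"
      and S1: "(\<Sum>\<^sub>\<infinity>k. w (k - 1) * norm (g (k - 1))) = S"
      using summable_on_reindex_bij_betw[OF bij_shift_int[of 1], where f = "\<lambda>k. w k * norm (g k)"]
        infsum_reindex_bij_betw[OF bij_shift_int[of 1], where f = "\<lambda>k. w k * norm (g k)"] sS
      by (simp_all add: S_def)
    \<comment> \<open>Moving the index by one changes \<open>w\<close> by at most 1, whatever
      \<open>N\<close> is; after summation this costs one \<open>G\<close>.\<close>
    have pt1: "w k * norm (g (k - 1)) \<le> w (k - 1) * norm (g (k - 1)) + norm (g (k - 1))"
      and pt2: "w (k - 1) * norm (g (k - 1)) \<le> w k * norm (g (k - 1)) + norm (g (k - 1))" for k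
      using mult_right_mono[of "w k" "w (k - 1) + 1" "norm (g (k - 1))"]
        mult_right_mono[of "w (k - 1)" "w k + 1" "norm (g (k - 1))"] w(4)[of k]
      by (auto simp: algebra_simps)
    have "U \<le> S + G"
      using infsum_mono[OF sU summable_on_add[OF sS1 g1] pt1]
      by (simp add: infsum_add[OF sS1 g1] S1 G1 U_def)
    moreover have "S \<le> U + G"
      using infsum_mono[OF sS1 summable_on_add[OF sU g1] pt2]
      by (simp add: infsum_add[OF sU g1] S1 G1 U_def)
    moreover
    \<comment> \<open>The triangle inequality compares \<open>g (k - 1)\<close> with
      \<open>r * g k\<close>; weighting the error by the full absolute value of \<open>k\<close>
      keeps \<open>H\<close> free of \<open>N\<close>.\<close>
    have pt3: "w k * norm (g (k - 1)) \<le>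
        norm r * (w k * norm (g k)) + \<bar>real_of_int k\<bar> * norm (g (k - 1) - r * g k)"
      and pt4: "norm r * (w k * norm (g k)) \<le>
        w k * norm (g (k - 1)) + \<bar>real_of_int k\<bar> * norm (g (k - 1) - r * g k)" for k
    proof -
      have a: "norm (g (k - 1)) \<le> norm r * norm (g k) + norm (g (k - 1) - r * g k)"
        using norm_triangle_ineq[of "r * g k" "g (k - 1) - r * g k"] by (simp add: norm_mult)
      have b: "norm r * norm (g k) \<le> norm (g (k - 1)) + norm (g (k - 1) - r * g k)"
        using norm_triangle_ineq4[of "g (k - 1)" "g (k - 1) - r * g k"] by (simp add: norm_mult)
      have c: "w k * norm (g (k - 1) - r * g k) \<le> \<bar>real_of_int k\<bar> * norm (g (k - 1) - r * g k)"
        by (intro mult_right_mono w) simp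
      show "w k * norm (g (k - 1)) \<le>
        norm r * (w k * norm (g k)) + \<bar>real_of_int k\<bar> * norm (g (k - 1) - r * g k)"
        using mult_left_mono[OF a w(1)[of k]] c by (simp add: algebra_simps)
      show "norm r * (w k * norm (g k)) \<le>
        w k * norm (g (k - 1)) + \<bar>real_of_int k\<bar> * norm (g (k - 1) - r * g k)"
        using mult_left_mono[OF b w(1)[of k]] c by (simp add: algebra_simps)
    qed
    note srS = summable_on_cmult_right[OF sS, of "norm r"]
    have "U \<le> norm r * S + H"
      using infsum_mono[OF sU summable_on_add[OF srS h] pt3]
      by (simp add: infsum_add[OF srS h] infsum_cmult_right' S_def H_def U_def)
    moreover have "norm r * S \<le> U + H"
      using infsum_mono[OF srS summable_on_add[OF sU h] pt4]
      by (simp add: infsum_add[OF sU h] infsum_cmult_right' S_def H_def U_def)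
    \<comment> \<open>Eliminating \<open>U\<close> bounds the gap between \<open>S\<close> and
      \<open>norm r * S\<close> by \<open>G + H\<close>, whether \<open>norm r\<close> lies above or
      below 1.\<close>
    ultimately have "\<bar>norm r - 1\<bar> * S \<le> G + H"
      by (auto simp: abs_if algebra_simps)
    then have "S \<le> B"
      using r' by (simp add: B_def field_simps)
    moreover have "(\<Sum>k\<in>F. \<bar>real_of_int k\<bar> * norm (g k)) \<le> S"
      unfolding S_def using finite_sum_le_infsum[OF sS F] w by (simp add: wF cong: sum.cong)
    ultimately show ?thesis by simp
  qed
  then show "bdd_above (sum (\<lambda>k. \<bar>real_of_int k\<bar> * norm (g k)) ` {F. F \<subseteq> UNIV \<and> finite F})"
    by (intro bdd_aboveI2[where M = B]) auto
qed auto

text \<open>Multiplying the symbol by one factor \<open>z - r\<close> turns \<open>g\<close> into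
  \<open>h k = g (k - 1) - r * g k\<close>, which satisfies the same relation with that factor
  removed. Induction gives \<open>h\<close> a first moment, and
  \<open>first_moment_deconvolve\<close> carries it back to \<open>g\<close>. With no factor left,
  uniqueness of coefficients confines \<open>g\<close> to the index \<open>i\<close>.\<close>

lemma first_moment_of_inverse:
  fixes g :: "int \<Rightarrow> complex"
  assumes "\<And>r. r \<in># M \<Longrightarrow> norm r \<noteq> 1"
    and "(\<lambda>k. norm (g k)) summable_on UNIV"
    and "\<And>z. norm z = 1 \<Longrightarrow> fourier_sum g z * (\<Prod>r\<in>#M. z - r) = a * z powi i"
  shows "(\<lambda>k. \<bar>real_of_int k\<bar> * norm (g k)) summable_on UNIV"
  using assms
proof (induction M arbitrary: g)
  case empty
  have "g = (\<lambda>k. if k = i then a else 0)"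
  proof (rule fourier_sum_unique)
    show "(\<lambda>k. norm (if k = i then a else 0)) summable_on UNIV"
      using summable_on_cong_neutral[of UNIV "{i}" "\<lambda>k. norm (if k = i then a else 0)"
          "\<lambda>k. norm (if k = i then a else 0)"] by simp
  qed (use empty in \<open>auto simp: fourier_sum_single\<close>)
  then show ?case
    using summable_on_cong_neutral[of UNIV "{i}" "\<lambda>k. \<bar>real_of_int k\<bar> * norm (g k)"
        "\<lambda>k. \<bar>real_of_int k\<bar> * norm (g k)"] by simp
next
  case (add r M)
  define h where "h k = g (k - 1) - r * g k" for k
  have g: "(\<lambda>k. norm (g k)) summable_on UNIV" by fact
  have g1: "(\<lambda>k. norm (g (k - 1))) summable_on UNIV"
    using summable_on_reindex_bij_betw[OF bij_shift_int[of 1], where f = "\<lambda>k. norm (g k)"] g by simp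
  have rg: "(\<lambda>k. norm (r * g k)) summable_on UNIV"
    using summable_on_cmult_right[OF g, of "norm r"] by (simp add: norm_mult)
  have "(\<lambda>k. \<bar>real_of_int k\<bar> * norm (h k)) summable_on UNIV"
  proof (rule add.IH)
    show "(\<lambda>k. norm (h k)) summable_on UNIV"
      unfolding h_def by (rule norm_summable_diff[OF g1 rg])
    fix z :: complex assume z: "norm z = 1"
    have "fourier_sum h z = (z - r) * fourier_sum g z"
      unfolding h_def
      by (simp add: fourier_sum_diff[OF g1 rg z] fourier_sum_shift[OF z] fourier_sum_cmult
          algebra_simps)
    then show "fourier_sum h z * (\<Prod>r\<in>#M. z - r) = a * z powi i"
      using add.prems(3)[OF z] by (simp add: mult_ac)
  qed (use add.prems in auto)
  then show ?case
    unfolding h_def by (intro first_moment_deconvolve[OF _ g]) (use add.prems in auto)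
qed

section \<open>Sums over the integers and symbols of real sequences\<close>

lemma infsum_reflect_int:
  fixes f :: "int \<Rightarrow> 'a :: {comm_monoid_add, t2_space}"
  shows "(\<Sum>\<^sub>\<infinity>k. f (j - k)) = (\<Sum>\<^sub>\<infinity>k. f k)"
  by (intro infsum_reindex_bij_betw bij_betwI[where g = "\<lambda>k. j - k"]) auto

lemma infsum_finite_support:
  assumes "finite A" and "\<And>k. k \<notin> A \<Longrightarrow> f k = 0"
  shows "(\<Sum>\<^sub>\<infinity>k. f k) = (\<Sum>k\<in>A. f k)"
  by (subst infsum_finite[OF assms(1), symmetric], rule infsum_cong_neutral) (use assms in auto)

lemma summable_on_finite_support:
  assumes "finite A" and "\<And>k. k \<notin> A \<Longrightarrow> f k = 0"
  shows "f summable_on UNIV"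
  by (rule summable_on_cong_neutral[THEN iffD2, of A UNIV f f]) (use assms in auto)

lemma fourier_sum_of_real: "fourier_sum (\<lambda>k. of_real (b k)) z = symbol b z"
  by (simp add: fourier_sum_def symbol_def)

lemma symbol_1: "symbol b 1 = of_real (\<Sum>\<^sub>\<infinity>k. b k)" if "(\<lambda>k. \<bar>b k\<bar>) summable_on UNIV"
proof -
  have "b summable_on UNIV"
    using that by (subst summable_on_iff_abs_summable_on_real) simp
  then show ?thesis
    unfolding symbol_def by (simp add: infsumI[OF has_sum_of_real[OF has_sum_infsum]])
qed

section \<open>Zeros of the pseudo-inverse, decay of \<open>\<gamma>\<close> and inversion by
  convolution\<close>

text \<open>One multiset for both products in \<open>pseudo_zero_prod\<close>, so that
  \<open>first_moment_of_inverse\<close> can treat kept and shifted zeros alike.\<close>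

definition pseudo_zeros :: "real \<Rightarrow> complex poly \<Rightarrow> complex multiset" where
  "pseudo_zeros \<xi> p = filter_mset (\<lambda>r. norm r \<noteq> 1) (proots p) +
     image_mset (\<lambda>r. of_real (1 + \<xi>) * r) (filter_mset (\<lambda>r. norm r = 1) (proots p))"

lemma pseudo_zero_prod_eq: "pseudo_zero_prod \<xi> p z = (\<Prod>r\<in>#pseudo_zeros \<xi> p. z - r)"
  by (simp add: pseudo_zero_prod_def pseudo_zeros_def multiset.map_comp o_def)

text \<open>Zeros off the unit circle are kept, and those on it move to modulus
  \<open>1 + \<xi> > 1\<close>.\<close>

lemma norm_pseudo_zeros:
  assumes "\<xi> > 0" and "r \<in># pseudo_zeros \<xi> p"
  shows "norm r \<noteq> 1"
proof -
  have "norm (of_real (1 + \<xi>) * s :: complex) \<noteq> 1" if "norm s = 1" for s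
    using that assms(1) by (simp only: norm_mult norm_of_real) simp
  then show ?thesis using assms(2) by (auto simp: pseudo_zeros_def)
qed

lemma pseudo_zero_prod_nonzero:
  assumes "\<xi> > 0" and "norm z = 1"
  shows "pseudo_zero_prod \<xi> p z \<noteq> 0"
  using norm_pseudo_zeros[OF assms(1), of z p] assms(2) by (auto simp: pseudo_zero_prod_eq)

lemma laurent_pseudo_inv_nonzero:
  assumes "\<xi> > 0" and "norm z = 1"
  shows "laurent_pseudo_inv \<xi> b z \<noteq> 0"
proof -
  have "z \<noteq> 0" using assms(2) by auto
  then show ?thesis
    using assms by (simp add: laurent_pseudo_inv_def pseudo_inv_def pseudo_zero_prod_nonzero)
qed

text \<open>Through this normalisation the entries of \<open>\<gamma>\<close> sum to 1, and so do
  those of \<open>down2 \<alpha>'\<close>, matching \<open>down2 \<alpha>\<close>.\<close>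

lemma laurent_pseudo_inv_1: "\<xi> > 0 \<Longrightarrow> laurent_pseudo_inv \<xi> b 1 = 1"
  using pseudo_zero_prod_nonzero[of \<xi> 1]
  by (simp add: laurent_pseudo_inv_def pseudo_inv_def)

text \<open>On the unit circle, the symbol of \<open>\<gamma>\<close> times the product over the
  pseudo zeros is a constant times \<open>z powi (- m)\<close>, so
  \<open>first_moment_of_inverse\<close> applies. Consequently the series in
  \<open>K_const \<gamma>\<close> converges.\<close>

lemma pseudo_reverse_first_moment:
  assumes "\<xi> > 0" and rev: "pseudo_reverse \<xi> \<alpha> \<gamma>"
  shows "(\<lambda>k. \<bar>\<gamma> k\<bar> * \<bar>real_of_int k\<bar>) summable_on UNIV"
proof -
  define p where "p = laurent_poly (down2 \<alpha>)"
  define m where "m = laurent_ord (down2 \<alpha>)"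
  have "(\<lambda>k. \<bar>real_of_int k\<bar> * norm (complex_of_real (\<gamma> k))) summable_on UNIV"
  proof (rule first_moment_of_inverse)
    fix z :: complex assume z: "norm z = 1"
    then have "z \<noteq> 0" by auto
    have "fourier_sum (\<lambda>k. of_real (\<gamma> k)) z =
        1 / (z powi m * (inverse (pseudo_zero_prod \<xi> p 1) * pseudo_zero_prod \<xi> p z))"
      using rev z
      by (simp add: fourier_sum_of_real pseudo_reverse_def laurent_pseudo_inv_def pseudo_inv_def
          p_def m_def)
    then show "fourier_sum (\<lambda>k. of_real (\<gamma> k)) z * (\<Prod>r\<in>#pseudo_zeros \<xi> p. z - r) =
        pseudo_zero_prod \<xi> p 1 * z powi (- m)"
      using pseudo_zero_prod_nonzero[OF \<open>\<xi> > 0\<close> z, of p] \<open>z \<noteq> 0\<close>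
      by (simp add: pseudo_zero_prod_eq[symmetric] power_int_minus field_simps)
  qed (use norm_pseudo_zeros[OF \<open>\<xi> > 0\<close>] rev in \<open>auto simp: pseudo_reverse_def\<close>)
  then show ?thesis by (simp add: mult.commute)
qed

text \<open>The symbol of a convolution is the product of the symbols, and the constant 1 is the
  symbol of the unit impulse; uniqueness of coefficients does the rest.\<close>

lemma convolution_inverse_of_symbol:
  fixes a \<gamma> :: "int \<Rightarrow> real"
  assumes A: "finite A" "\<And>k. k \<notin> A \<Longrightarrow> a k = 0" and \<gamma>: "(\<lambda>k. \<bar>\<gamma> k\<bar>) summable_on UNIV"
    and inv: "\<And>z. norm z = 1 \<Longrightarrow> symbol a z * symbol \<gamma> z = 1"
  shows "(\<Sum>i\<in>A. a i * \<gamma> (n - i)) = (if n = 0 then 1 else 0)"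
proof -
  define g where "g k = complex_of_real (\<gamma> k)" for k
  have g: "(\<lambda>k. norm (g (k - i))) summable_on UNIV" for i
    using \<gamma> summable_on_reindex_bij_betw[OF bij_shift_int[of i], where f = "\<lambda>k. \<bar>\<gamma> k\<bar>"]
    by (simp add: g_def)
  have g_symbol: "fourier_sum g z = symbol \<gamma> z" for z
    by (simp add: g_def[abs_def] fourier_sum_of_real)
  have ag: "(\<lambda>n. norm (of_real (a i) * g (n - i))) summable_on UNIV" for i
    using summable_on_cmult_right[OF g[of i], of "norm (a i)"] by (simp add: norm_mult)
  have "(\<lambda>n. \<Sum>i\<in>A. of_real (a i) * g (n - i)) = (\<lambda>n. if n = 0 then 1 else 0)"
  proof (rule fourier_sum_unique)
    show "(\<lambda>n. norm (\<Sum>i\<in>A. of_real (a i) * g (n - i))) summable_on UNIV"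
      by (rule summable_on_comparison_test[OF infsum_sum_swap(1)[OF A(1) ag]])
         (auto intro: norm_sum)
    show "(\<lambda>n::int. norm (if n = 0 then 1 else 0 :: complex)) summable_on UNIV"
      by (rule summable_on_finite_support[of "{0}"]) auto
    fix z :: complex assume z: "norm z = 1"
    have "fourier_sum (\<lambda>n. \<Sum>i\<in>A. of_real (a i) * g (n - i)) z =
        (\<Sum>\<^sub>\<infinity>n. \<Sum>i\<in>A. of_real (a i) * g (n - i) * z powi n)"
      by (simp add: fourier_sum_def sum_distrib_right)
    also have "\<dots> = (\<Sum>i\<in>A. fourier_sum (\<lambda>n. of_real (a i) * g (n - i)) z)"
      unfolding fourier_sum_def
      by (rule infsum_sum_swap(2)[OF A(1)]) (rule summable_fourier[OF ag z])
    also have "\<dots> = (\<Sum>i\<in>A. of_real (a i) * z powi i) * symbol \<gamma> z"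
      by (simp add: fourier_sum_cmult fourier_sum_shift[OF z] sum_distrib_right mult.assoc
          g_symbol)
    also have "(\<Sum>i\<in>A. of_real (a i) * z powi i) = symbol a z"
      unfolding symbol_def by (rule infsum_finite_support[symmetric]) (use A in auto)
    finally show "fourier_sum (\<lambda>n. \<Sum>i\<in>A. of_real (a i) * g (n - i)) z =
        fourier_sum (\<lambda>n. if n = 0 then 1 else 0) z"
      using inv[OF z] by (simp add: fourier_sum_single)
  qed
  from fun_cong[OF this, of n] have "complex_of_real (\<Sum>i\<in>A. a i * \<gamma> (n - i)) =
      of_real (if n = 0 then 1 else 0)"
    by (simp add: g_def)
  then show ?thesis by (simp only: of_real_eq_iff)
qed

section \<open>Decimation of Lipschitz sequences\<close>

text \<open>Lipschitz data may be unbounded but grow at most linearly, so the first moment of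
  \<open>\<gamma>\<close> supplies a summable majorant.\<close>

lemma summable_first_moment_Lipschitz:
  fixes e \<gamma> :: "int \<Rightarrow> real"
  assumes \<gamma>: "(\<lambda>k. \<bar>\<gamma> k\<bar>) summable_on UNIV" "(\<lambda>k. \<bar>\<gamma> k\<bar> * \<bar>real_of_int k\<bar>) summable_on UNIV"
    and e: "\<And>i j. \<bar>e i - e j\<bar> \<le> M * \<bar>real_of_int (i - j)\<bar>"
  shows "(\<lambda>k. \<bar>\<gamma> k * e (j - k)\<bar>) summable_on UNIV" (is ?abs)
    and "(\<lambda>k. \<gamma> k * e (j - k)) summable_on UNIV"
proof -
  have le: "\<bar>\<gamma> k * e (j - k)\<bar> \<le> \<bar>e j\<bar> * \<bar>\<gamma> k\<bar> + M * (\<bar>\<gamma> k\<bar> * \<bar>real_of_int k\<bar>)" for k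
  proof -
    have "\<bar>e (j - k)\<bar> \<le> \<bar>e j\<bar> + M * \<bar>real_of_int k\<bar>"
      using e[of "j - k" j] by simp
    then show ?thesis
      using mult_left_mono[of "\<bar>e (j - k)\<bar>" "\<bar>e j\<bar> + M * \<bar>real_of_int k\<bar>" "\<bar>\<gamma> k\<bar>"]
      by (simp add: abs_mult algebra_simps)
  qed
  show ?abs
    by (rule summable_on_comparison_test[OF summable_on_add[OF
            summable_on_cmult_right[OF \<gamma>(1)] summable_on_cmult_right[OF \<gamma>(2)]] le]) simp
  then show "(\<lambda>k. \<gamma> k * e (j - k)) summable_on UNIV"
    by (subst summable_on_iff_abs_summable_on_real) simp
qed

text \<open>With \<open>j\<close> placed in the data instead of in \<open>\<gamma>\<close>,
  differences in \<open>j\<close> fall on the data.\<close>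

lemma decimate_eq: "decimate \<gamma> c j = (\<Sum>\<^sub>\<infinity>k. \<gamma> k * down2 c (j - k))"
  unfolding decimate_def down2_def
  using infsum_reflect_int[of "\<lambda>k. \<gamma> (j - k) * c (2 * k)" j] by simp

lemma Lipschitz_down2:
  fixes c :: "int \<Rightarrow> real"
  assumes "\<And>i j. \<bar>c i - c j\<bar> \<le> M * \<bar>real_of_int (i - j)\<bar>"
  shows "\<bar>down2 c i - down2 c j\<bar> \<le> 2 * M * \<bar>real_of_int (i - j)\<bar>"
proof -
  have "\<bar>real_of_int (2 * i - 2 * j)\<bar> = 2 * \<bar>real_of_int (i - j)\<bar>"
    by (simp add: abs_if algebra_simps)
  then show ?thesis using assms[of "2 * i" "2 * j"] by (simp only: down2_def mult_ac)
qed

text \<open>In the difference of the two convolutions every \<open>\<gamma> k\<close> multiplies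
  data at the same distance \<open>i - j\<close>, so the Lipschitz bound of \<open>down2 c\<close>
  factors out of the sum.\<close>

lemma decimate_Lipschitz:
  fixes c \<gamma> :: "int \<Rightarrow> real"
  assumes \<gamma>: "(\<lambda>k. \<bar>\<gamma> k\<bar>) summable_on UNIV" "(\<lambda>k. \<bar>\<gamma> k\<bar> * \<bar>real_of_int k\<bar>) summable_on UNIV"
    and c: "\<And>i j. \<bar>c i - c j\<bar> \<le> M * \<bar>real_of_int (i - j)\<bar>"
  shows "\<bar>decimate \<gamma> c i - decimate \<gamma> c j\<bar> \<le> 2 * l1_norm \<gamma> * M * \<bar>real_of_int (i - j)\<bar>"
proof -
  note e = Lipschitz_down2[OF c]
  note s = summable_first_moment_Lipschitz[OF \<gamma> e]
  let ?D = "2 * M * \<bar>real_of_int (i - j)\<bar>"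
  have d: "\<gamma> k * down2 c (i - k) - \<gamma> k * down2 c (j - k) =
      \<gamma> k * (down2 c (i - k) - down2 c (j - k))" for k by (simp add: algebra_simps)
  have "decimate \<gamma> c i - decimate \<gamma> c j =
      (\<Sum>\<^sub>\<infinity>k. \<gamma> k * (down2 c (i - k) - down2 c (j - k)))"
    unfolding decimate_eq using infsum_add[OF s(2)[of i] summable_on_uminus[THEN iffD2, OF s(2)[of j]]]
    by (simp add: infsum_uminus algebra_simps)
  moreover have le: "\<bar>\<gamma> k * (down2 c (i - k) - down2 c (j - k))\<bar> \<le> ?D * \<bar>\<gamma> k\<bar>" for k
    using mult_right_mono[OF e[of "i - k" "j - k"], of "\<bar>\<gamma> k\<bar>"] by (simp add: abs_mult mult_ac)
  have abs: "(\<lambda>k. \<bar>\<gamma> k * (down2 c (i - k) - down2 c (j - k))\<bar>) summable_on UNIV"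
    by (rule summable_on_comparison_test[OF summable_on_cmult_right[OF \<gamma>(1)] le]) simp
  have "\<bar>\<Sum>\<^sub>\<infinity>k. \<gamma> k * (down2 c (i - k) - down2 c (j - k))\<bar> \<le>
      (\<Sum>\<^sub>\<infinity>k. \<bar>\<gamma> k * (down2 c (i - k) - down2 c (j - k))\<bar>)"
    using norm_infsum_bound[of "\<lambda>k. \<gamma> k * (down2 c (i - k) - down2 c (j - k))" UNIV] abs by simp
  also have "\<dots> \<le> (\<Sum>\<^sub>\<infinity>k. ?D * \<bar>\<gamma> k\<bar>)"
    by (rule infsum_mono[OF abs summable_on_cmult_right[OF \<gamma>(1)] le])
  also have "\<dots> = 2 * l1_norm \<gamma> * M * \<bar>real_of_int (i - j)\<bar>"
    unfolding infsum_cmult_right' l1_norm_def by (simp add: mult_ac)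
  ultimately show ?thesis by (simp only:)
qed

text \<open>As \<open>\<gamma>\<close> sums to 1, \<open>down2 c j\<close> can be drawn into the
  convolution. The weight \<open>\<gamma> k\<close> then meets data at distance at most the sum of
  the absolute values of \<open>i\<close> and \<open>k\<close>: the first part yields
  \<open>l1_norm\<close>, the second \<open>K_const\<close>, whose factor 2 is the one from
  \<open>Lipschitz_down2\<close>.\<close>

lemma decimate_local_bound:
  fixes c \<gamma> :: "int \<Rightarrow> real"
  assumes \<gamma>: "(\<lambda>k. \<bar>\<gamma> k\<bar>) summable_on UNIV" "(\<lambda>k. \<bar>\<gamma> k\<bar> * \<bar>real_of_int k\<bar>) summable_on UNIV"
    and sum1: "(\<Sum>\<^sub>\<infinity>k. \<gamma> k) = 1" and "M \<ge> 0"
    and c: "\<And>i j. \<bar>c i - c j\<bar> \<le> M * \<bar>real_of_int (i - j)\<bar>"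
  shows "\<bar>decimate \<gamma> c (j - i) - down2 c j\<bar> \<le> M * (2 * l1_norm \<gamma> * \<bar>real_of_int i\<bar> + K_const \<gamma>)"
proof -
  note e = Lipschitz_down2[OF c]
  note s = summable_first_moment_Lipschitz[OF \<gamma> e]
  have sg: "\<gamma> summable_on UNIV"
    using \<gamma>(1) by (subst summable_on_iff_abs_summable_on_real) simp
  let ?t = "\<lambda>k. \<gamma> k * (down2 c (j - i - k) - down2 c j)"
  let ?B = "\<lambda>k. (2 * M * \<bar>real_of_int i\<bar>) * \<bar>\<gamma> k\<bar> + (2 * M) * (\<bar>\<gamma> k\<bar> * \<bar>real_of_int k\<bar>)"
  have eq: "decimate \<gamma> c (j - i) - down2 c j = (\<Sum>\<^sub>\<infinity>k. ?t k)"
    unfolding decimate_eq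
    using infsum_add[OF s(2)[of "j - i"] summable_on_cmult_left[OF sg, of "- down2 c j"]]
    by (simp add: sum1 infsum_uminus infsum_cmult_left' algebra_simps)
  have le: "\<bar>?t k\<bar> \<le> ?B k" for k
  proof -
    have "\<bar>real_of_int (j - i - k - j)\<bar> \<le> \<bar>real_of_int i\<bar> + \<bar>real_of_int k\<bar>" by simp
    from mult_left_mono[OF this, of "2 * M"] e[of "j - i - k" j] \<open>M \<ge> 0\<close>
    have "\<bar>down2 c (j - i - k) - down2 c j\<bar> \<le> 2 * M * (\<bar>real_of_int i\<bar> + \<bar>real_of_int k\<bar>)"
      by linarith
    then have "\<bar>?t k\<bar> \<le> \<bar>\<gamma> k\<bar> * (2 * M * (\<bar>real_of_int i\<bar> + \<bar>real_of_int k\<bar>))"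
      unfolding abs_mult by (intro mult_left_mono) auto
    also have "\<dots> = ?B k" by (simp add: algebra_simps)
    finally show ?thesis .
  qed
  have sB: "?B summable_on UNIV"
    by (intro summable_on_add summable_on_cmult_right \<gamma>)
  have abs: "(\<lambda>k. \<bar>?t k\<bar>) summable_on UNIV"
    by (rule summable_on_comparison_test[OF sB le]) simp
  have "\<bar>\<Sum>\<^sub>\<infinity>k. ?t k\<bar> \<le> (\<Sum>\<^sub>\<infinity>k. \<bar>?t k\<bar>)"
    using norm_infsum_bound[of ?t UNIV] abs by simp
  also have "\<dots> \<le> (\<Sum>\<^sub>\<infinity>k. ?B k)"
    by (rule infsum_mono[OF abs sB le])
  also have "\<dots> = M * (2 * l1_norm \<gamma> * \<bar>real_of_int i\<bar> + K_const \<gamma>)"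
    unfolding infsum_add[OF summable_on_cmult_right[OF \<gamma>(1)] summable_on_cmult_right[OF \<gamma>(2)]]
      infsum_cmult_right' l1_norm_def K_const_def
    by (simp add: algebra_simps)
  finally show ?thesis by (simp only: eq)
qed

section \<open>Refinement at even indices and the even details\<close>

text \<open>At even indices only even mask entries meet the data, so refinement becomes a finite
  convolution with \<open>down2 \<alpha>\<close>.\<close>

lemma refine_even:
  assumes "finite A" and "\<And>k. k \<notin> A \<Longrightarrow> \<alpha> (2 * k) = 0"
  shows "refine \<alpha> g (2 * j) = (\<Sum>i\<in>A. \<alpha> (2 * i) * g (j - i))"
proof -
  have "refine \<alpha> g (2 * j) = (\<Sum>\<^sub>\<infinity>i. \<alpha> (2 * i) * g (j - i))"
    unfolding refine_def
    using infsum_reflect_int[of "\<lambda>k. \<alpha> (2 * j - 2 * k) * g k" j] by (simp add: algebra_simps)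
  also have "\<dots> = (\<Sum>i\<in>A. \<alpha> (2 * i) * g (j - i))"
    by (rule infsum_finite_support) (use assms in auto)
  finally show ?thesis .
qed

text \<open>Associativity of convolution: the finite sum over \<open>A\<close> is moved onto
  \<open>\<gamma>\<close>, where \<open>inv\<close> leaves only the term
  \<open>n = 0\<close>.\<close>

lemma convolve_decimate:
  fixes a c \<gamma> :: "int \<Rightarrow> real"
  assumes A: "finite A" and \<gamma>: "(\<lambda>k. \<bar>\<gamma> k\<bar>) summable_on UNIV"
      "(\<lambda>k. \<bar>\<gamma> k\<bar> * \<bar>real_of_int k\<bar>) summable_on UNIV"
    and c: "\<And>i j. \<bar>c i - c j\<bar> \<le> M * \<bar>real_of_int (i - j)\<bar>"
    and inv: "\<And>n. (\<Sum>i\<in>A. a i * \<gamma> (n - i)) = (if n = 0 then 1 else 0)"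
  shows "(\<Sum>i\<in>A. a i * decimate \<gamma> c (j - i)) = down2 c j"
proof -
  note s = summable_first_moment_Lipschitz[OF \<gamma> Lipschitz_down2[OF c]]
  \<comment> \<open>Substituting \<open>n = k + i\<close> moves \<open>i\<close> from the data to
    \<open>\<gamma>\<close>.\<close>
  have s': "(\<lambda>n. \<gamma> (n - i) * down2 c (j - n)) summable_on UNIV"
    and d: "decimate \<gamma> c (j - i) = (\<Sum>\<^sub>\<infinity>n. \<gamma> (n - i) * down2 c (j - n))" for i
    using summable_on_reindex_bij_betw[OF bij_shift_int[of i],
          where f = "\<lambda>k. \<gamma> k * down2 c (j - i - k)"]
        infsum_reindex_bij_betw[OF bij_shift_int[of i],
          where f = "\<lambda>k. \<gamma> k * down2 c (j - i - k)"] s(2)[of "j - i"]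
    by (simp_all add: decimate_eq)
  have "(\<Sum>i\<in>A. a i * decimate \<gamma> c (j - i)) =
      (\<Sum>\<^sub>\<infinity>n. \<Sum>i\<in>A. a i * (\<gamma> (n - i) * down2 c (j - n)))"
    by (subst infsum_sum_swap(2)[OF A])
       (auto intro: summable_on_cmult_right s' simp: d infsum_cmult_right')
  also have "\<dots> = (\<Sum>\<^sub>\<infinity>n. (\<Sum>i\<in>A. a i * \<gamma> (n - i)) * down2 c (j - n))"
    by (simp add: sum_distrib_right mult.assoc)
  also have "\<dots> = (\<Sum>n\<in>{0}. (\<Sum>i\<in>A. a i * \<gamma> (n - i)) * down2 c (j - n))"
    by (rule infsum_finite_support) (auto simp: inv)
  finally show ?thesis by (simp add: inv[of 0, simplified])
qed

text \<open>The even entries of the approximating mask invert \<open>\<gamma>\<close>, so refining with it reproduces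
  \<open>down2 c\<close>, and only \<open>\<alpha> - \<alpha>'\<close> contributes to the detail; as its even entries sum to zero,
  \<open>decimate \<gamma> c\<close> may be replaced by its deviation from \<open>down2 c j\<close>.\<close>
lemma even_detail_bound:
  fixes \<alpha> \<alpha>' \<gamma> c :: "int \<Rightarrow> real"
  assumes fin: "finite {k. \<alpha> k \<noteq> 0}" "finite {k. \<alpha>' k \<noteq> 0}"
    and sum_eq: "(\<Sum>\<^sub>\<infinity>k. down2 \<alpha> k) = (\<Sum>\<^sub>\<infinity>k. down2 \<alpha>' k)"
    and \<gamma>: "(\<lambda>k. \<bar>\<gamma> k\<bar>) summable_on UNIV" "(\<lambda>k. \<bar>\<gamma> k\<bar> * \<bar>real_of_int k\<bar>) summable_on UNIV"
    and sum1: "(\<Sum>\<^sub>\<infinity>k. \<gamma> k) = 1"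
    and inv: "\<And>z. norm z = 1 \<Longrightarrow> symbol (down2 \<alpha>') z * symbol \<gamma> z = 1"
    and "M \<ge> 0" and c: "\<And>i j. \<bar>c i - c j\<bar> \<le> M * \<bar>real_of_int (i - j)\<bar>"
  shows "\<bar>c (2 * j) - refine \<alpha> (decimate \<gamma> c) (2 * j)\<bar> \<le>
    (l1_norm (\<lambda>k. \<alpha> k - \<alpha>' k) * K_const \<gamma> + l1_norm \<gamma> * K_const (\<lambda>k. \<alpha> k - \<alpha>' k)) * M"
proof -
  define \<delta> where "\<delta> k = \<alpha> k - \<alpha>' k" for k
  \<comment> \<open>A common finite index set for the even entries of both masks, so that their sums
    can be subtracted termwise.\<close>
  define A where "A = (\<lambda>k. k div 2) ` ({k. \<alpha> k \<noteq> 0} \<union> {k. \<alpha>' k \<noteq> 0})"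
  define g where "g = decimate \<gamma> c"
  have A: "finite A" using fin by (simp add: A_def)
  have "i \<in> A" if "\<alpha> (2 * i) \<noteq> 0 \<or> \<alpha>' (2 * i) \<noteq> 0" for i
    unfolding A_def using that by (intro image_eqI[where x = "2 * i"]) auto
  then have A0: "i \<notin> A \<Longrightarrow> \<alpha> (2 * i) = 0" "i \<notin> A \<Longrightarrow> \<alpha>' (2 * i) = 0" for i
    by auto
  have conv: "(\<Sum>i\<in>A. down2 \<alpha>' i * \<gamma> (n - i)) = (if n = 0 then 1 else 0)" for n
    by (rule convolution_inverse_of_symbol[OF A _ \<gamma>(1) inv]) (simp_all add: down2_def A0)
  have rep: "c (2 * j) = (\<Sum>i\<in>A. \<alpha>' (2 * i) * g (j - i))"
    using convolve_decimate[OF A \<gamma> c conv, of j] by (simp add: g_def down2_def)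
  have ref: "refine \<alpha> g (2 * j) = (\<Sum>i\<in>A. \<alpha> (2 * i) * g (j - i))"
    by (rule refine_even[OF A]) (rule A0(1))
  have \<delta>0: "(\<Sum>i\<in>A. \<delta> (2 * i)) = 0"
    using sum_eq infsum_finite_support[OF A, of "down2 \<alpha>"] infsum_finite_support[OF A, of "down2 \<alpha>'"]
    by (simp add: \<delta>_def sum_subtractf down2_def A0)
  have "c (2 * j) - refine \<alpha> g (2 * j) = - (\<Sum>i\<in>A. \<delta> (2 * i) * g (j - i))"
    by (simp add: rep ref \<delta>_def left_diff_distrib sum_subtractf)
  also have "\<dots> = - (\<Sum>i\<in>A. \<delta> (2 * i) * (g (j - i) - down2 c j))"
    using \<delta>0 by (simp add: right_diff_distrib sum_subtractf flip: sum_distrib_right)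
  finally have "\<bar>c (2 * j) - refine \<alpha> g (2 * j)\<bar> \<le>
      (\<Sum>i\<in>A. \<bar>\<delta> (2 * i)\<bar> * \<bar>g (j - i) - down2 c j\<bar>)"
    using sum_abs[of "\<lambda>i. \<delta> (2 * i) * (g (j - i) - down2 c j)" A] by (simp add: abs_mult)
  also have "\<dots> \<le> (\<Sum>i\<in>A. \<bar>\<delta> (2 * i)\<bar> * (M * (2 * l1_norm \<gamma> * \<bar>real_of_int i\<bar> + K_const \<gamma>)))"
    unfolding g_def
    by (intro sum_mono mult_left_mono decimate_local_bound[OF \<gamma> sum1 \<open>M \<ge> 0\<close> c]) simp
  also have "\<dots> = M * ((\<Sum>i\<in>A. \<bar>\<delta> (2 * i)\<bar>) * K_const \<gamma> +
      l1_norm \<gamma> * (2 * (\<Sum>i\<in>A. \<bar>\<delta> (2 * i)\<bar> * \<bar>real_of_int i\<bar>)))"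
    by (simp add: sum_distrib_left sum_distrib_right sum.distrib algebra_simps)
  also have "\<dots> \<le> M * (l1_norm \<delta> * K_const \<gamma> + l1_norm \<gamma> * K_const \<delta>)"
  proof (intro mult_left_mono add_mono mult_right_mono)
    have s: "(\<lambda>k. \<bar>\<delta> k\<bar>) summable_on UNIV" "(\<lambda>k. \<bar>\<delta> k\<bar> * \<bar>real_of_int k\<bar>) summable_on UNIV"
      using fin
      by (auto intro!: summable_on_finite_support[of "{k. \<alpha> k \<noteq> 0} \<union> {k. \<alpha>' k \<noteq> 0}"] simp: \<delta>_def)
    \<comment> \<open>The even indices are a subset of all indices and \<open>i\<close> is at most
      \<open>2 * i\<close> in absolute value, so sums over even entries are dominated by those over
      all of \<open>\<delta>\<close>.\<close>
    have inj: "inj_on (\<lambda>i::int. 2 * i) A" by (simp add: inj_on_def)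
    show "(\<Sum>i\<in>A. \<bar>\<delta> (2 * i)\<bar>) \<le> l1_norm \<delta>"
      using finite_sum_le_infsum[OF s(1), of "(\<lambda>i. 2 * i) ` A"] A
      by (simp add: l1_norm_def sum.reindex[OF inj])
    have "(\<Sum>i\<in>A. \<bar>\<delta> (2 * i)\<bar> * \<bar>real_of_int i\<bar>) \<le> (\<Sum>i\<in>A. \<bar>\<delta> (2 * i)\<bar> * \<bar>real_of_int (2 * i)\<bar>)"
      by (intro sum_mono mult_left_mono) auto
    also have "\<dots> \<le> (\<Sum>\<^sub>\<infinity>k. \<bar>\<delta> k\<bar> * \<bar>real_of_int k\<bar>)"
      using finite_sum_le_infsum[OF s(2), of "(\<lambda>i. 2 * i) ` A"] A
      by (simp add: sum.reindex[OF inj])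
    finally show "2 * (\<Sum>i\<in>A. \<bar>\<delta> (2 * i)\<bar> * \<bar>real_of_int i\<bar>) \<le> K_const \<delta>"
      by (simp add: K_const_def)
    show "0 \<le> K_const \<gamma>" "0 \<le> l1_norm \<gamma>"
      by (auto simp: K_const_def l1_norm_def intro!: infsum_nonneg)
  qed fact
  finally show ?thesis by (simp add: g_def \<delta>_def[abs_def] mult.commute)
qed

section \<open>Sampling \<open>f\<close> and descending through the levels\<close>

lemma Lipschitz_of_bounded_deriv:
  fixes f :: "real \<Rightarrow> real"
  assumes "\<And>x. f differentiable (at x)" and "bounded (range (deriv f))"
  shows "\<bar>f x - f y\<bar> \<le> (SUP x. \<bar>deriv f x\<bar>) * \<bar>x - y\<bar>"
proof -
  have bdd: "bdd_above (range (\<lambda>x. \<bar>deriv f x\<bar>))"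
    using assms(2) by (auto simp: bounded_iff bdd_above_def)
  have "norm (f x - f y) \<le> (SUP x. \<bar>deriv f x\<bar>) * norm (x - y)"
    by (rule field_differentiable_bound[of UNIV f "deriv f"])
       (use assms(1) in \<open>auto intro: cSUP_upper[OF _ bdd] simp: DERIV_deriv_iff_real_differentiable\<close>)
  then show ?thesis by simp
qed

theorem theorem3p4:
  fixes J :: nat and f :: "real \<Rightarrow> real" and \<alpha> \<gamma> \<alpha>' :: "int \<Rightarrow> real" and \<xi> :: real
    and c d :: "nat \<Rightarrow> int \<Rightarrow> real"
  assumes "\<forall>x. f differentiable (at x)" and "bounded (range (deriv f))"
    and "\<forall>j. c J j = f (real_of_int j / 2 ^ J)"
    and "refinement_mask \<alpha>" and "convergent_scheme \<alpha>"
    and "\<xi> > 0" and "pseudo_reverse \<xi> \<alpha> \<gamma>" and "approximating_mask \<xi> \<alpha> \<alpha>'"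
    and "multiscale_rep \<alpha> \<gamma> J c d"
  defines "L \<equiv> l1_norm (\<lambda>k. \<alpha> k - \<alpha>' k) * K_const \<gamma> + l1_norm \<gamma> * K_const (\<lambda>k. \<alpha> k - \<alpha>' k)"
  defines "P \<equiv> L * l1_norm \<gamma> ^ J * (SUP x. \<bar>deriv f x\<bar>)"
  shows "\<forall>l\<in>{1..J}. linf_norm (down2 (d l)) \<le> ereal (P * (2 * l1_norm \<gamma>) powi (- int l))"
proof -
  define G where "G = l1_norm \<gamma>"
  define F where "F = (SUP x. \<bar>deriv f x\<bar>)"
  \<comment> \<open>The Lipschitz constant at level \<open>l\<close>: it is \<open>F / 2 ^ J\<close>
    for the samples at level \<open>J\<close>, and each of the \<open>J - l\<close> decimations
    multiplies it by \<open>2 * G\<close>.\<close>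
  define M where "M l = F * G ^ J / (2 * G) ^ l" for l
  have sym: "symbol \<gamma> z = 1 / laurent_pseudo_inv \<xi> (down2 \<alpha>) z" if "norm z = 1" for z
    using assms(7) that by (auto simp: pseudo_reverse_def)
  have \<gamma>1: "(\<lambda>k. \<bar>\<gamma> k\<bar>) summable_on UNIV"
    using assms(7) by (auto simp: pseudo_reverse_def)
  have \<gamma>2: "(\<lambda>k. \<bar>\<gamma> k\<bar> * \<bar>real_of_int k\<bar>) summable_on UNIV"
    by (rule pseudo_reverse_first_moment) fact+
  have sym': "symbol (down2 \<alpha>') z = laurent_pseudo_inv \<xi> (down2 \<alpha>) z" if "z \<noteq> 0" for z
    using assms(8) that by (auto simp: approximating_mask_def)
  have fin: "finite {k. \<alpha> k \<noteq> 0}" "finite {k. \<alpha>' k \<noteq> 0}"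
    using assms(4,8) by (auto simp: refinement_mask_def approximating_mask_def)
  have "complex_of_real (\<Sum>\<^sub>\<infinity>k. \<gamma> k) = 1"
    using sym[of 1] symbol_1[OF \<gamma>1] laurent_pseudo_inv_1[OF \<open>\<xi> > 0\<close>, of "down2 \<alpha>"] by simp
  then have sum1: "(\<Sum>\<^sub>\<infinity>k. \<gamma> k) = 1" by simp
  have "finite {k. down2 \<alpha>' k \<noteq> 0}"
    using finite_vimageI[OF fin(2), of "\<lambda>k. 2 * k"] by (simp add: down2_def inj_def vimage_def)
  then have "(\<lambda>k. \<bar>down2 \<alpha>' k\<bar>) summable_on UNIV"
    by (rule summable_on_finite_support) auto
  then have "complex_of_real (\<Sum>\<^sub>\<infinity>k. down2 \<alpha>' k) = 1"
    using sym'[of 1] symbol_1[of "down2 \<alpha>'"] laurent_pseudo_inv_1[OF \<open>\<xi> > 0\<close>, of "down2 \<alpha>"]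
    by simp
  then have sum_eq: "(\<Sum>\<^sub>\<infinity>k. down2 \<alpha> k) = (\<Sum>\<^sub>\<infinity>k. down2 \<alpha>' k)"
    using assms(4) by (simp add: refinement_mask_def down2_def)
  have inv: "symbol (down2 \<alpha>') z * symbol \<gamma> z = 1" if "norm z = 1" for z
  proof -
    have "z \<noteq> 0" using that by auto
    then show ?thesis
      using laurent_pseudo_inv_nonzero[OF \<open>\<xi> > 0\<close> that, of "down2 \<alpha>"] by (simp add: sym sym' that)
  qed
  \<comment> \<open>The entries of \<open>\<gamma>\<close> sum to 1, so the sum of their absolute
    values is at least 1; this justifies dividing by \<open>2 * G\<close>.\<close>
  have "1 \<le> G"
    using norm_infsum_bound[of \<gamma> UNIV] \<gamma>1 by (simp add: sum1 G_def l1_norm_def)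
  have "bdd_above (range (\<lambda>x. \<bar>deriv f x\<bar>))"
    using assms(2) by (auto simp: bounded_iff bdd_above_def)
  then have "0 \<le> F" unfolding F_def by (rule cSUP_upper2[where x = 0]) auto
  then have M0: "M l \<ge> 0" for l
    using \<open>1 \<le> G\<close> by (simp add: M_def)
  have M_step: "2 * G * M (Suc n) = M n" for n
    using \<open>1 \<le> G\<close> by (simp add: M_def)
  have lip: "\<bar>c l i - c l j\<bar> \<le> M l * \<bar>real_of_int (i - j)\<bar>" if "l \<le> J" for l i j
    using that
  \<comment> \<open>Downward induction, starting from the samples at level \<open>J\<close>.\<close>
  proof (induction arbitrary: i j rule: inc_induct)
    case base
    have MJ: "M J = F / 2 ^ J"
      using \<open>1 \<le> G\<close> by (simp add: M_def power_mult_distrib)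
    have "\<bar>real_of_int i / 2 ^ J - real_of_int j / 2 ^ J\<bar> = \<bar>real_of_int (i - j)\<bar> / 2 ^ J"
      by (simp add: abs_divide flip: diff_divide_distrib)
    then show ?case
      using Lipschitz_of_bounded_deriv[of f "real_of_int i / 2 ^ J" "real_of_int j / 2 ^ J"] assms(1-3)
      by (simp add: MJ F_def)
  next
    case (step n)
    \<comment> \<open>The recursion is read at \<open>Suc n\<close>, which lies in
      \<open>{1..J}\<close> because \<open>n < J\<close>.\<close>
    have "c n = decimate \<gamma> (c (Suc n))"
      using assms(9) step(2) by (fastforce simp: multiscale_rep_def dest: bspec[where x = "Suc n"])
    then show ?case
      using decimate_Lipschitz[OF \<gamma>1 \<gamma>2 step.IH, of i j] M_step[of n] by (simp add: G_def)
  qed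
  show ?thesis
  proof
    fix l assume l: "l \<in> {1..J}"
    then have d: "d l = (\<lambda>j. c l j - refine \<alpha> (decimate \<gamma> (c l)) j)"
      using assms(9) by (simp add: multiscale_rep_def)
    have "\<bar>down2 (d l) j\<bar> \<le> L * M l" for j
      unfolding d L_def down2_def
      by (rule even_detail_bound[OF fin sum_eq \<gamma>1 \<gamma>2 sum1 inv M0 lip]) (use l in auto)
    \<comment> \<open>The factor \<open>G ^ J\<close> of \<open>P\<close> is the one in the closed
      form of \<open>M l\<close>.\<close>
    moreover have "P * (2 * l1_norm \<gamma>) powi (- int l) = L * M l"
      by (simp add: P_def M_def F_def G_def power_int_minus divide_inverse mult_ac)
    ultimately show "linf_norm (down2 (d l)) \<le> ereal (P * (2 * l1_norm \<gamma>) powi (- int l))"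
      unfolding linf_norm_def by (intro SUP_least) simp
  qed
qed

end
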